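(* Let $P_T(x,y,z) = x^3+2x^2y+x^2z+2xy^2-2xyz-xz^2+2y^3-2yz^2+z^3$, and let $(T_n)_{n\in\mathbb{Z}}$ be the Tribonacci numbers defined by $T_0 = T_1 = 0$, $T_2 = 1$, and $T_n = T_{n-1}+T_{n-2}+T_{n-3}$ for all integers $n$ (so that for negative indices $T_n = T_{n+3} - T_{n+2} - T_{n+1}$). If $x, y, z$ are integers with $P_T(x,y,z) = 1$, then $(x,y,z) = (T_n, T_{n+1}, T_{n+2})$ for some integer $n$. *)

theory Defs
  imports Main
begin

definition P_T :: "int \<Rightarrow> int \<Rightarrow> int \<Rightarrow> int" where
  "P_T x y z = x^3 + 2*x^2*y + x^2*z + 2*x*y^2 - 2*x*y*z - x*z^2 + 2*y^3 - 2*y*z^2 + z^3"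

function tribonacci :: "int \<Rightarrow> int" where
  "tribonacci n =
    (if n < 0 then tribonacci (n + 3) - tribonacci (n + 2) - tribonacci (n + 1)
     else if n = 0 \<or> n = 1 then 0
     else if n = 2 then 1
     else tribonacci (n - 1) + tribonacci (n - 2) + tribonacci (n - 3))"
  by auto
termination
  by (relation "measure (\<lambda>n. if n < 0 then nat (3 - n) else nat n)") auto

declare tribonacci.simps [simp del]

lemma tribonacci_0: "tribonacci 0 = 0"
  and tribonacci_1: "tribonacci 1 = 0"
  and tribonacci_2: "tribonacci 2 = 1"
  by (simp_all add: tribonacci.simps)

lemma tribonacci_rec:
  "tribonacci n = tribonacci (n - 1) + tribonacci (n - 2) + tribonacci (n - 3)"
proof (cases "n > 2")
  case True
  then show ?thesis by (subst tribonacci.simps) simp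
next
  case False
  then have "tribonacci (n - 3) = tribonacci n - tribonacci (n - 1) - tribonacci (n - 2)"
    by (subst tribonacci.simps) simp
  then show ?thesis by simp
qed

end

theory Submission
  imports Defs Complex_Main
begin

text \<open>
  Let \<open>\<alpha>\<close> be the real root of \<open>t\<^sup>3 = t\<^sup>2 + t + 1\<close>, and \<open>\<beta>\<close> one of the two complex conjugate roots.
  Then \<open>P_T\<close> is the norm of the linear form \<open>L\<^sub>t = z + (t - 1) y + x / t\<close>, that is,
  \<open>P_T = L\<^sub>\<alpha> |L\<^sub>\<beta>|\<^sup>2\<close>. The Tribonacci shift \<open>(x, y, z) \<mapsto> (y, z, x + y + z)\<close> multiplies \<open>L\<^sub>t\<close> by \<open>t\<close> and
  so preserves \<open>P_T\<close>. Hence the orbit of every solution of \<open>P_T = 1\<close> contains a solution with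
  \<open>1 \<le> L\<^sub>\<alpha> < \<alpha>\<close>. For it \<open>|L\<^sub>\<beta>| \<le> 1\<close>, and these bounds leave only \<open>(0, 0, 1)\<close>.
\<close>

lemma ex_powi_mult_between:
  fixes b r :: real
  assumes "1 < b" "0 < r"
  obtains n :: int where "1 \<le> b powi n * r" "b powi n * r < b"
proof
  define n where "n = - \<lfloor>log b r\<rfloor>"
  have eq: "b powi n * r = b powr (n + log b r)"
    using assms by (simp add: powr_add powr_real_of_int')
  have "b powr 0 \<le> b powr (n + log b r)"
    using assms by (intro powr_mono) (simp_all add: n_def)
  then show "1 \<le> b powi n * r"
    using assms eq by simp
  have "b powr (n + log b r) < b powr 1"
    using assms by (intro powr_less_mono) (simp_all add: n_def, linarith)
  then show "b powi n * r < b"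
    using assms eq by simp
qed

subsection \<open>Two-sided Tribonacci sequences\<close>

definition trib_sequence :: "(int \<Rightarrow> 'a::ab_group_add) \<Rightarrow> bool" where
  "trib_sequence s \<longleftrightarrow> (\<forall>n. s (n + 3) = s n + s (n + 1) + s (n + 2))"

lemma trib_sequenceD: "trib_sequence s \<Longrightarrow> s (n + 3) = s n + s (n + 1) + s (n + 2)"
  by (simp add: trib_sequence_def)

lemma trib_sequence_tribonacci: "trib_sequence tribonacci"
  unfolding trib_sequence_def
proof
  show "tribonacci (n + 3) = tribonacci n + tribonacci (n + 1) + tribonacci (n + 2)" for n
    using tribonacci_rec[of "n + 3"] by (simp add: add.commute)
qed

lemma trib_sequence_translate:
  assumes "trib_sequence s"
  shows "trib_sequence (\<lambda>n. s (n + k))"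
  unfolding trib_sequence_def
proof
  show "s (n + 3 + k) = s (n + k) + s (n + 1 + k) + s (n + 2 + k)" for n
    using trib_sequenceD[OF assms, of "n + k"] by (simp add: ac_simps)
qed

lemma trib_sequence_eqI:
  assumes s: "trib_sequence s" and t: "trib_sequence t"
    and init: "s k = t k" "s (k + 1) = t (k + 1)" "s (k + 2) = t (k + 2)"
  shows "s = t"
proof
  fix n
  have "s n = t n \<and> s (n + 1) = t (n + 1) \<and> s (n + 2) = t (n + 2)"
  proof (induction n rule: int_induct[of _ k])
    case base
    show ?case using init by simp
  next
    case (step1 n)
    then show ?case
      using trib_sequenceD[OF s, of n] trib_sequenceD[OF t, of n] by (simp add: add.assoc)
  next
    case (step2 n)
    then show ?case
      using trib_sequenceD[OF s, of "n - 1"] trib_sequenceD[OF t, of "n - 1"]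
      by (simp add: add.commute)
  qed
  then show "s n = t n" ..
qed

lemma ex_trib_sequence:
  fixes x y z :: int
  obtains s where "trib_sequence s" "s 0 = x" "s 1 = y" "s 2 = z"
proof
  let ?T = tribonacci
  define s where "s n = x * ?T (n - 1) + y * (?T (n + 1) - ?T n) + z * ?T n" for n
  show "trib_sequence s"
    unfolding trib_sequence_def
  proof
    fix n
    have "?T (n + 2) = ?T (n - 1) + ?T n + ?T (n + 1)"
      using trib_sequenceD[OF trib_sequence_tribonacci, of "n - 1"] by (simp add: add.commute)
    moreover have "?T (n + 3) = ?T n + ?T (n + 1) + ?T (n + 2)"
      using trib_sequenceD[OF trib_sequence_tribonacci, of n] .
    moreover have "?T (n + 4) = ?T (n + 1) + ?T (n + 2) + ?T (n + 3)"
      using trib_sequenceD[OF trib_sequence_tribonacci, of "n + 1"] by (simp add: add.assoc)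
    ultimately show "s (n + 3) = s n + s (n + 1) + s (n + 2)"
      by (simp add: s_def algebra_simps)
  qed
  have "?T (-1) = 1" "?T 3 = 1"
    using tribonacci_rec[of 2] tribonacci_rec[of 3]
    by (simp_all add: tribonacci_0 tribonacci_1 tribonacci_2)
  then show "s 0 = x" "s 1 = y" "s 2 = z"
    by (simp_all add: s_def tribonacci_0 tribonacci_1 tribonacci_2)
qed

lemma P_T_trib_sequence:
  assumes "trib_sequence s"
  shows "P_T (s n) (s (n + 1)) (s (n + 2)) = P_T (s 0) (s 1) (s 2)"
proof -
  have shift: "P_T y z (x + y + z) = P_T x y z" for x y z
    unfolding P_T_def by algebra
  show ?thesis
  proof (induction n rule: int_induct[of _ 0])
    case base
    show ?case by simp
  next
    case (step1 n)
    then show ?case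
      using shift[of "s (n + 1)" "s (n + 2)" "s n"] trib_sequenceD[OF assms, of n]
      by (simp add: add.assoc)
  next
    case (step2 n)
    then show ?case
      using shift[of "s n" "s (n + 1)" "s (n - 1)"] trib_sequenceD[OF assms, of "n - 1"]
      by (simp add: add.commute)
  qed
qed

subsection \<open>The linear form whose norm is \<open>P_T\<close>\<close>

text \<open>At a root \<open>t\<close> of \<open>t\<^sup>3 = t\<^sup>2 + t + 1\<close> the coefficient of \<open>x\<close> is \<open>1 / t\<close>.\<close>

definition trib_form :: "'a::comm_ring_1 \<Rightarrow> int \<Rightarrow> int \<Rightarrow> int \<Rightarrow> 'a" where
  "trib_form t x y z = of_int z + (t - 1) * of_int y + (t\<^sup>2 - t - 1) * of_int x"

lemma trib_form_shift:
  assumes "t ^ 3 = t\<^sup>2 + t + 1"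
  shows "trib_form t y z (x + y + z) = t * trib_form t x y z"
proof -
  have "t * trib_form t x y z - trib_form t y z (x + y + z) =
      (t ^ 3 - (t\<^sup>2 + t + 1)) * of_int x"
    by (simp add: trib_form_def algebra_simps power2_eq_square power3_eq_cube)
  then show ?thesis
    using assms by simp
qed

lemma trib_form_uminus: "trib_form t (- x) (- y) (- z) = - trib_form t x y z"
  by (simp add: trib_form_def)

lemma trib_form_trib_sequence:
  fixes t :: "'a::field"
  assumes root: "t ^ 3 = t\<^sup>2 + t + 1" and s: "trib_sequence s"
  shows "trib_form t (s n) (s (n + 1)) (s (n + 2)) = t powi n * trib_form t (s 0) (s 1) (s 2)"
proof -
  have "t \<noteq> 0"
    using root by auto
  have shift: "trib_form t (s (m + 1)) (s (m + 2)) (s (m + 3)) =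
      t * trib_form t (s m) (s (m + 1)) (s (m + 2))" for m
    using trib_form_shift[OF root] trib_sequenceD[OF s, of m] by simp
  show ?thesis
  proof (induction n rule: int_induct[of _ 0])
    case base
    show ?case by simp
  next
    case (step1 n)
    then show ?case
      using shift[of n] \<open>t \<noteq> 0\<close> by (simp add: power_int_add_1' add.assoc)
  next
    case (step2 n)
    then show ?case
      using shift[of "n - 1"] \<open>t \<noteq> 0\<close> by (simp add: power_int_diff field_simps)
  qed
qed

lemma trib_root_if_Vieta:
  fixes a b c :: "'a::comm_ring_1"
  assumes "a + b + c = 1" "a * b + a * c + b * c = -1" "a * b * c = 1"
  shows "a ^ 3 = a\<^sup>2 + a + 1"
proof -
  have "a ^ 3 = a\<^sup>2 * (a + b + c) - a * (a * b + a * c + b * c) + a * b * c"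
    by (simp add: algebra_simps power2_eq_square power3_eq_cube)
  then show ?thesis
    unfolding assms by simp
qed

text \<open>
  Expressing \<open>c\<close>, \<open>b\<^sup>2\<close> and \<open>a\<^sup>3\<close> by lower powers gives every polynomial in the three roots a
  normal form.
\<close>

lemma P_T_eq_prod_trib_form:
  fixes a b c :: "'a::comm_ring_1"
  assumes Vieta: "a + b + c = 1" "a * b + a * c + b * c = -1" "a * b * c = 1"
  shows "of_int (P_T x y z) = trib_form a x y z * trib_form b x y z * trib_form c x y z"
proof -
  have c_eq: "c = 1 - a - b"
    using Vieta(1) by (simp add: algebra_simps)
  have b_sq: "b * b = 1 - a * a - a * b + a + b"
    using Vieta(2) unfolding c_eq by (simp add: algebra_simps)
  have a_cube: "a * (a * a) = a * a + a + 1"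
    using trib_root_if_Vieta[OF Vieta] by (simp add: power2_eq_square power3_eq_cube mult.assoc)
  have b_sq_mult: "b * (b * d) = d - a * (a * d) - a * (b * d) + a * d + b * d" for d
    using arg_cong[OF b_sq, of "\<lambda>t. t * d"] by (simp add: algebra_simps)
  have a_cube_mult: "a * (a * (a * d)) = a * (a * d) + a * d + d" for d
    using arg_cong[OF a_cube, of "\<lambda>t. t * d"] by (simp add: algebra_simps)
  show ?thesis
    unfolding P_T_def trib_form_def c_eq power2_eq_square power3_eq_cube
    by (simp add: algebra_simps b_sq b_sq_mult a_cube a_cube_mult)
qed

subsection \<open>The roots of the Tribonacci polynomial\<close>

text \<open>The bound is \<open>1 < \<alpha>\<^sup>2 (Im \<beta>)\<^sup>2\<close>, since \<open>(Im \<beta>)\<^sup>2 = 1 / \<alpha> - (Re \<beta>)\<^sup>2\<close>.\<close>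

lemma trib_root_Im_bound:
  fixes \<alpha> :: real
  assumes root: "\<alpha> ^ 3 = \<alpha>\<^sup>2 + \<alpha> + 1" and "5 / 3 < \<alpha>"
  shows "1 < \<alpha>\<^sup>2 * (1 / \<alpha> - ((1 - \<alpha>) / 2)\<^sup>2)"
proof -
  have "\<alpha>\<^sup>2 - \<alpha> = 1 + 1 / \<alpha>"
    using assms by (simp add: field_simps power2_eq_square power3_eq_cube)
  also have "1 / \<alpha> < 3 / 5"
    using \<open>5 / 3 < \<alpha>\<close> by (simp add: field_simps)
  finally have "(\<alpha>\<^sup>2 - \<alpha>)\<^sup>2 \<le> (8 / 5)\<^sup>2"
    using \<open>5 / 3 < \<alpha>\<close> \<open>\<alpha>\<^sup>2 - \<alpha> = 1 + 1 / \<alpha>\<close> by (intro power_mono) simp_all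
  then have "1 < \<alpha> - (\<alpha>\<^sup>2 - \<alpha>)\<^sup>2 / 4"
    using \<open>5 / 3 < \<alpha>\<close> by (simp add: power2_eq_square)
  also have "\<dots> = \<alpha>\<^sup>2 * (1 / \<alpha> - ((1 - \<alpha>) / 2)\<^sup>2)"
    using \<open>5 / 3 < \<alpha>\<close> by (simp add: field_simps power2_eq_square)
  finally show ?thesis .
qed

lemma ex_trib_real_root:
  obtains \<alpha> :: real where "\<alpha> ^ 3 = \<alpha>\<^sup>2 + \<alpha> + 1" "5 / 3 < \<alpha>" "\<alpha> < 2"
proof -
  let ?f = "\<lambda>t::real. t ^ 3 - t\<^sup>2 - t - 1"
  have "\<exists>t\<ge>5 / 3. t \<le> 2 \<and> ?f t = 0"
    by (rule IVT) (auto simp: power3_eq_cube power2_eq_square intro!: continuous_intros)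
  then obtain t where t: "5 / 3 \<le> t" "t \<le> 2" "?f t = 0"
    by blast
  have "?f (5 / 3) \<noteq> 0" "?f 2 \<noteq> 0"
    by (simp_all add: power3_eq_cube power2_eq_square)
  then have "t \<noteq> 5 / 3" "t \<noteq> 2"
    using t(3) by metis+
  then show thesis
    using t by (intro that[of t]) auto
qed

locale tribonacci_roots =
  fixes \<alpha> :: real and \<beta> :: complex
  assumes sum_roots: "of_real \<alpha> + \<beta> + cnj \<beta> = 1"
    and sum_prod_roots: "of_real \<alpha> * \<beta> + of_real \<alpha> * cnj \<beta> + \<beta> * cnj \<beta> = -1"
    and prod_roots: "of_real \<alpha> * \<beta> * cnj \<beta> = 1"
    and \<alpha>_gt: "5 / 3 < \<alpha>" and \<alpha>_less: "\<alpha> < 2"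
begin

lemma \<alpha>_root: "\<alpha> ^ 3 = \<alpha>\<^sup>2 + \<alpha> + 1"
proof -
  have "(of_real \<alpha> :: complex) ^ 3 = (of_real \<alpha>)\<^sup>2 + of_real \<alpha> + 1"
    using sum_roots sum_prod_roots prod_roots by (rule trib_root_if_Vieta)
  then have "(of_real (\<alpha> ^ 3) :: complex) = of_real (\<alpha>\<^sup>2 + \<alpha> + 1)"
    by simp
  then show ?thesis
    unfolding of_real_eq_iff .
qed

lemma Re_\<beta>: "Re \<beta> = (1 - \<alpha>) / 2"
  using arg_cong[OF sum_roots, of Re] by simp

lemma Im_\<beta>_gt: "1 < \<alpha> * \<bar>Im \<beta>\<bar>"
proof -
  have "\<alpha> * ((Re \<beta>)\<^sup>2 + (Im \<beta>)\<^sup>2) = 1"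
    using arg_cong[OF prod_roots, of Re] by (simp add: power2_eq_square algebra_simps)
  then have "(Im \<beta>)\<^sup>2 = 1 / \<alpha> - ((1 - \<alpha>) / 2)\<^sup>2"
    using \<alpha>_gt unfolding Re_\<beta> by (simp add: field_simps)
  then have "1\<^sup>2 < (\<alpha> * \<bar>Im \<beta>\<bar>)\<^sup>2"
    using trib_root_Im_bound[OF \<alpha>_root \<alpha>_gt] by (simp add: power_mult_distrib)
  then show ?thesis
    by (rule power_less_imp_less_base) (use \<alpha>_gt in simp)
qed

lemma trib_form_\<beta>:
  "trib_form \<beta> x y z = of_int z + (\<beta> - 1) * of_int y + of_real \<alpha> * cnj \<beta> * of_int x"
proof -
  have "\<beta>\<^sup>2 - \<beta> - 1 = of_real \<alpha> * cnj \<beta>"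
    using sum_roots sum_prod_roots by algebra
  then show ?thesis
    by (simp add: trib_form_def)
qed

lemma Re_trib_form_\<beta>:
  "Re (trib_form \<beta> x y z) = z - (\<alpha> + 1) / 2 * y - \<alpha> * (\<alpha> - 1) / 2 * x"
  unfolding trib_form_\<beta> by (simp add: Re_\<beta> field_simps)

lemma Im_trib_form_\<beta>: "Im (trib_form \<beta> x y z) = Im \<beta> * (y - \<alpha> * x)"
  unfolding trib_form_\<beta> by (simp add: algebra_simps)

lemma P_T_eq_trib_form_norm:
  "of_int (P_T x y z) = trib_form \<alpha> x y z * (cmod (trib_form \<beta> x y z))\<^sup>2"
proof -
  have "of_int (P_T x y z) =
      trib_form (of_real \<alpha>) x y z * trib_form \<beta> x y z * trib_form (cnj \<beta>) x y z"
    using sum_roots sum_prod_roots prod_roots by (rule P_T_eq_prod_trib_form)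
  also have "trib_form (of_real \<alpha>) x y z = complex_of_real (trib_form \<alpha> x y z)"
    by (simp add: trib_form_def)
  also have "trib_form (cnj \<beta>) x y z = cnj (trib_form \<beta> x y z)"
    by (simp add: trib_form_def)
  finally have "complex_of_real (of_int (P_T x y z)) =
      of_real (trib_form \<alpha> x y z * (cmod (trib_form \<beta> x y z))\<^sup>2)"
    by (simp add: mult.assoc flip: complex_norm_square)
  then show ?thesis
    unfolding of_real_eq_iff .
qed

subsection \<open>Solutions of \<open>P_T = 1\<close>\<close>

lemma trib_form_pos:
  assumes "P_T x y z = 1"
  shows "0 < trib_form \<alpha> x y z"
proof -
  have "0 < trib_form \<alpha> x y z * (cmod (trib_form \<beta> x y z))\<^sup>2"
    using P_T_eq_trib_form_norm[of x y z] assms by simp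
  then show ?thesis
    by (simp add: zero_less_mult_iff)
qed

lemma norm_trib_form_\<beta>_le_1:
  assumes "P_T x y z = 1" "1 \<le> trib_form \<alpha> x y z"
  shows "cmod (trib_form \<beta> x y z) \<le> 1"
proof -
  have "1 * (cmod (trib_form \<beta> x y z))\<^sup>2 \<le> trib_form \<alpha> x y z * (cmod (trib_form \<beta> x y z))\<^sup>2"
    using assms(2) by (rule mult_right_mono) simp
  also have "\<dots> = 1"
    using P_T_eq_trib_form_norm[of x y z] assms(1) by simp
  finally show ?thesis
    by (simp add: abs_square_le_1)
qed

lemma abs_diff_less_if_norm_trib_form_\<beta>_le_1:
  assumes "cmod (trib_form \<beta> x y z) \<le> 1"
  shows "\<bar>y - \<alpha> * x\<bar> < \<alpha>"
proof -
  have "\<bar>Im \<beta>\<bar> * \<bar>y - \<alpha> * x\<bar> = \<bar>Im (trib_form \<beta> x y z)\<bar>"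
    by (simp add: Im_trib_form_\<beta> abs_mult)
  also have "\<dots> \<le> cmod (trib_form \<beta> x y z)"
    by (rule abs_Im_le_cmod)
  also have "\<dots> < \<bar>Im \<beta>\<bar> * \<alpha>"
    using assms Im_\<beta>_gt by (simp add: mult.commute)
  finally show ?thesis
    by (rule mult_left_less_imp_less) simp
qed

lemma trib_form_diff_Re_\<beta>:
  "trib_form \<alpha> x y z - Re (trib_form \<beta> x y z) =
    (3 * \<alpha> - 1) / 2 * y + (3 * \<alpha>\<^sup>2 - 3 * \<alpha> - 2) / 2 * x"
  unfolding Re_trib_form_\<beta> by (simp add: trib_form_def field_simps power2_eq_square)

lemma trib_form_diff_Re_\<beta>_gt:
  assumes "\<bar>y - \<alpha> * x\<bar> < \<alpha>" and "1 \<le> x"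
  shows "\<alpha> + 1 < trib_form \<alpha> x y z - Re (trib_form \<beta> x y z)"
proof -
  have "\<alpha> * 1 \<le> \<alpha> * x"
    using \<open>1 \<le> x\<close> \<alpha>_gt by (intro mult_left_mono) simp_all
  then have "0 < real_of_int y"
    using assms(1) by linarith
  then have "1 \<le> y"
    by simp
  have "(5 / 3) * (\<alpha> + 1) < \<alpha> * (\<alpha> + 1)"
    using \<alpha>_gt by (intro mult_strict_right_mono) simp_all
  then have sq: "5 / 3 * \<alpha> + 5 / 3 < \<alpha>\<^sup>2 + \<alpha>"
    by (simp add: power2_eq_square algebra_simps)
  then have "\<alpha> + 1 < (3 * \<alpha> - 1) / 2 * 1 + (3 * \<alpha>\<^sup>2 - 3 * \<alpha> - 2) / 2 * 1"
    by (simp add: field_simps)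
  also have "\<dots> \<le> (3 * \<alpha> - 1) / 2 * y + (3 * \<alpha>\<^sup>2 - 3 * \<alpha> - 2) / 2 * x"
    using \<open>1 \<le> x\<close> \<open>1 \<le> y\<close> \<alpha>_gt \<alpha>_less sq by (intro add_mono mult_left_mono) simp_all
  finally show ?thesis
    by (simp only: trib_form_diff_Re_\<beta>)
qed

text \<open>
  The bound on \<open>Im L\<^sub>\<beta>\<close> puts \<open>y\<close> within distance \<open>\<alpha>\<close> of \<open>\<alpha> x\<close>. If \<open>x \<noteq> 0\<close>, then \<open>y\<close> has the
  sign of \<open>x\<close>, and \<open>L\<^sub>\<alpha> - Re L\<^sub>\<beta>\<close>, a combination of \<open>x\<close> and \<open>y\<close> with positive coefficients, leaves
  the interval \<open>[0, \<alpha> + 1)\<close>.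
\<close>

lemma P_T_eq_1_window_imp_0_0_1:
  assumes P: "P_T x y z = 1"
    and ge: "1 \<le> trib_form \<alpha> x y z" and less: "trib_form \<alpha> x y z < \<alpha>"
  shows "x = 0" "y = 0" "z = 1"
proof -
  let ?d = "trib_form \<alpha> x y z - Re (trib_form \<beta> x y z)"
  have norm: "cmod (trib_form \<beta> x y z) \<le> 1"
    using P ge by (rule norm_trib_form_\<beta>_le_1)
  then have "\<bar>Re (trib_form \<beta> x y z)\<bar> \<le> 1"
    using abs_Re_le_cmod order_trans by blast
  then have diff: "0 \<le> ?d" "?d < \<alpha> + 1"
    using ge less by linarith+
  have close: "\<bar>y - \<alpha> * x\<bar> < \<alpha>"
    using norm by (rule abs_diff_less_if_norm_trib_form_\<beta>_le_1)
  have "\<not> 1 \<le> x"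
    using trib_form_diff_Re_\<beta>_gt[OF close, of z] diff(2) by linarith
  moreover have "\<not> 1 \<le> - x"
    using trib_form_diff_Re_\<beta>_gt[of "- y" "- x" "- z"] close diff(1) \<alpha>_gt
    by (auto simp: trib_form_uminus abs_minus_commute)
  ultimately show x: "x = 0"
    by linarith
  have "0 < (3 * \<alpha> - 1) / 2"
    using \<alpha>_gt by simp
  moreover have "(3 * \<alpha> - 1) / 2 * (-1) < (3 * \<alpha> - 1) / 2 * y"
      "(3 * \<alpha> - 1) / 2 * y < (3 * \<alpha> - 1) / 2 * 2"
    using diff \<alpha>_gt unfolding trib_form_diff_Re_\<beta> x by (simp_all add: field_simps)
  ultimately have "-1 < real_of_int y" "real_of_int y < 2"
    using mult_less_cancel_left_pos by blast+
  then consider "y = 0" | "y = 1"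
    by linarith
  then show y: "y = 0"
  proof cases
    assume "y = 1"
    then have "0 < real_of_int z" "real_of_int z < 1"
      using ge less \<alpha>_less by (simp_all add: x trib_form_def)
    then show ?thesis
      by simp
  qed
  have "1 \<le> real_of_int z" "real_of_int z < 2"
    using ge less \<alpha>_less by (simp_all add: x y trib_form_def)
  then show "z = 1"
    by linarith
qed

end

lemma ex_tribonacci_roots: "\<exists>\<alpha> \<beta>. tribonacci_roots \<alpha> \<beta>"
proof -
  obtain \<alpha> :: real where root: "\<alpha> ^ 3 = \<alpha>\<^sup>2 + \<alpha> + 1" and bounds: "5 / 3 < \<alpha>" "\<alpha> < 2"
    by (rule ex_trib_real_root)
  define \<beta> where "\<beta> = Complex ((1 - \<alpha>) / 2) (sqrt (1 / \<alpha> - ((1 - \<alpha>) / 2)\<^sup>2))"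
  have "0 < \<alpha>\<^sup>2 * (1 / \<alpha> - ((1 - \<alpha>) / 2)\<^sup>2)"
    using trib_root_Im_bound[OF root bounds(1)] by linarith
  then have "(Im \<beta>)\<^sup>2 = 1 / \<alpha> - (Re \<beta>)\<^sup>2"
    by (simp add: \<beta>_def zero_less_mult_iff)
  then have norm_\<beta>: "\<beta> * cnj \<beta> = of_real (1 / \<alpha>)"
    by (simp add: complex_mult_cnj)
  have trace_\<beta>: "\<beta> + cnj \<beta> = of_real (1 - \<alpha>)"
    by (simp add: complex_add_cnj \<beta>_def)
  have "tribonacci_roots \<alpha> \<beta>"
  proof
    show "of_real \<alpha> + \<beta> + cnj \<beta> = 1"
      using trace_\<beta> by (simp add: add.assoc)
    have "of_real \<alpha> * \<beta> + of_real \<alpha> * cnj \<beta> + \<beta> * cnj \<beta> =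
        of_real \<alpha> * (\<beta> + cnj \<beta>) + \<beta> * cnj \<beta>"
      by (simp add: distrib_left)
    also have "\<dots> = of_real (\<alpha> * (1 - \<alpha>) + 1 / \<alpha>)"
      unfolding trace_\<beta> norm_\<beta> by simp
    also have "\<alpha> * (1 - \<alpha>) + 1 / \<alpha> = -1"
      using root bounds by (simp add: field_simps power2_eq_square power3_eq_cube)
    finally show "of_real \<alpha> * \<beta> + of_real \<alpha> * cnj \<beta> + \<beta> * cnj \<beta> = -1"
      by simp
    show "of_real \<alpha> * \<beta> * cnj \<beta> = 1"
      using norm_\<beta> bounds by (simp add: mult.assoc)
  qed (fact bounds)+
  then show ?thesis by blast
qed

theorem theorem3p4:
  fixes x y z :: int
  assumes "P_T x y z = 1"
  shows "\<exists>n::int. (x, y, z) = (tribonacci n, tribonacci (n + 1), tribonacci (n + 2))"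
proof -
  obtain \<alpha> \<beta> where "tribonacci_roots \<alpha> \<beta>"
    using ex_tribonacci_roots by blast
  then interpret tribonacci_roots \<alpha> \<beta> .
  obtain s where s: "trib_sequence s" and init: "s 0 = x" "s 1 = y" "s 2 = z"
    by (rule ex_trib_sequence)
  obtain n where "1 \<le> \<alpha> powi n * trib_form \<alpha> x y z" "\<alpha> powi n * trib_form \<alpha> x y z < \<alpha>"
    using ex_powi_mult_between[of \<alpha>] trib_form_pos[OF assms] \<alpha>_gt by auto
  then have "s n = 0" "s (n + 1) = 0" "s (n + 2) = 1"
    using P_T_eq_1_window_imp_0_0_1[of "s n" "s (n + 1)" "s (n + 2)"] P_T_trib_sequence[OF s, of n]
      trib_form_trib_sequence[OF \<alpha>_root s, of n] assms init by simp_all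
  then have "s = (\<lambda>m. tribonacci (m + - n))"
    using s trib_sequence_translate[OF trib_sequence_tribonacci, of "- n"]
    by (intro trib_sequence_eqI[of _ _ n])
      (simp_all add: tribonacci_0 tribonacci_1 tribonacci_2)
  then show ?thesis
    using init by (intro exI[of _ "- n"]) (auto simp: add.commute)
qed

end
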